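(* The space of Liouvillian forms with linear coefficients on a $2n$-dimensional exact symplectic manifold $(M,\omega)$ has dimension $n(2n+1)$ (as an affine space over $\mathbb{R}$).
   Context: One works in local coordinates $z=(z_1,\dots,z_{2n})$ on $M$ in which $\omega=\sum_{i,j}\tfrac12J_{ij}\,dz_j\wedge dz_i$ with a constant real matrix $J=[J_{ij}]$ satisfying $J^T=-J$, $J^2=-I_{2n}$. A Liouvillian form on $(M,\omega)$ is a 1-form $\theta$ with $d\theta=\omega$. It has linear coefficients if $\theta=\sum_i\alpha_i(z)\,dz_i$ with $\alpha_i(z)=\sum_jA_{ij}z_j$ for a constant real matrix $A=[A_{ij}]\in\mathbb{M}_{2n\times2n}(\mathbb{R})$. *)

theory Defs
  imports "HOL-Analysis.Analysis" "HOL-Library.Function_Algebras"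
begin

text \<open>Functions into a real vector space form a real vector space, with pointwise operations;
  spaces of differential forms are subsets of such function spaces.\<close>

instantiation "fun" :: (type, real_vector) real_vector
begin

definition scaleR_fun :: "real \<Rightarrow> ('a \<Rightarrow> 'b) \<Rightarrow> 'a \<Rightarrow> 'b" where
  "scaleR_fun c f = (\<lambda>x. c *\<^sub>R f x)"

instance
  by standard (auto simp: scaleR_fun_def fun_eq_iff scaleR_add_right scaleR_add_left)

end

text \<open>The library's \<^const>\<open>aff_dim\<close> is restricted to Euclidean spaces. The witnessing basis is
  required to be finite, so that an infinite-dimensional space has no dimension at all.\<close>

definition has_affine_dim :: "'a::real_vector set \<Rightarrow> nat \<Rightarrow> bool" where
  "has_affine_dim S d \<longleftrightarrow> S \<noteq> {} \<and> affine S \<and>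
     (\<exists>B. finite B \<and> independent B \<and> span B = {x - y | x y. x \<in> S \<and> y \<in> S} \<and> card B = d)"

text \<open>Smooth functions on an open set, through iterated directional derivatives.\<close>

primrec Ck_on :: "nat \<Rightarrow> ('a::real_normed_vector \<Rightarrow> 'b::real_normed_vector) \<Rightarrow> 'a set \<Rightarrow> bool" where
  "Ck_on 0 f U \<longleftrightarrow> continuous_on U f"
| "Ck_on (Suc k) f U \<longleftrightarrow>
     f differentiable_on U \<and> (\<forall>v. Ck_on k (\<lambda>x. frechet_derivative f (at x) v) U)"

definition smooth_on :: "('a::real_normed_vector \<Rightarrow> 'b::real_normed_vector) \<Rightarrow> 'a set \<Rightarrow> bool" where
  "smooth_on f U \<longleftrightarrow> (\<forall>k. Ck_on k f U)"

text \<open>Forms in coordinates. They live on a coordinate domain \<open>U\<close>, an open set of coordinate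
  vectors \<open>z = (z\<^sub>i)\<close>, with the index type \<open>'m\<close> playing the role of the index set \<open>{1..2n}\<close>.
  The value at \<open>z\<close> of a 1-form is a covector, that of a 2-form a function of two tangent vectors.
  A 1-form on \<open>U\<close> is normalised to vanish outside \<open>U\<close>, so that two 1-forms on \<open>U\<close> are equal
  in HOL exactly if they agree on \<open>U\<close>.\<close>

type_synonym 'm one_form = "real^'m \<Rightarrow> ((real^'m) \<Rightarrow>\<^sub>L real)"
type_synonym 'm two_form = "real^'m \<Rightarrow> real^'m \<Rightarrow> real^'m \<Rightarrow> real"

definition one_form_on :: "(real^'m) set \<Rightarrow> 'm::finite one_form \<Rightarrow> bool" where
  "one_form_on U \<theta> \<longleftrightarrow> smooth_on \<theta> U \<and> (\<forall>z. z \<notin> U \<longrightarrow> \<theta> z = 0)"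

definition two_form_on :: "(real^'m) set \<Rightarrow> 'm::finite two_form \<Rightarrow> bool" where
  "two_form_on U \<omega> \<longleftrightarrow>
     (\<forall>z\<in>U. bilinear (\<omega> z) \<and> (\<forall>v. \<omega> z v v = 0)) \<and> (\<forall>u v. smooth_on (\<lambda>z. \<omega> z u v) U)"

definition dz :: "'m::finite \<Rightarrow> (real^'m) \<Rightarrow>\<^sub>L real" where
  "dz i = Blinfun (\<lambda>v. v $ i)"

definition wedge :: "((real^'m) \<Rightarrow>\<^sub>L real) \<Rightarrow> ((real^'m) \<Rightarrow>\<^sub>L real) \<Rightarrow> real^'m::finite \<Rightarrow> real^'m \<Rightarrow> real"
  where "wedge \<alpha> \<beta> = (\<lambda>u v. blinfun_apply \<alpha> u * blinfun_apply \<beta> v - blinfun_apply \<alpha> v * blinfun_apply \<beta> u)"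

text \<open>Exterior derivatives at a point, evaluated on constant vector fields, so that the bracket
  terms of the invariant formula drop out. With the convention of \<^const>\<open>wedge\<close>,
  \<open>d(\<Sum>\<^sub>i \<alpha>\<^sub>i dz\<^sub>i) = \<Sum>\<^sub>i d\<alpha>\<^sub>i \<and> dz\<^sub>i\<close>.\<close>

definition ext_deriv1 :: "'m::finite one_form \<Rightarrow> 'm two_form" where
  "ext_deriv1 \<theta> z u v =
     blinfun_apply (frechet_derivative \<theta> (at z) u) v - blinfun_apply (frechet_derivative \<theta> (at z) v) u"

definition ext_deriv2 :: "'m::finite two_form \<Rightarrow> real^'m \<Rightarrow> real^'m \<Rightarrow> real^'m \<Rightarrow> real^'m \<Rightarrow> real" where
  "ext_deriv2 \<omega> z u v w =
     frechet_derivative (\<lambda>x. \<omega> x v w) (at z) u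
   - frechet_derivative (\<lambda>x. \<omega> x u w) (at z) v
   + frechet_derivative (\<lambda>x. \<omega> x u v) (at z) w"

definition symplectic_form_on :: "(real^'m) set \<Rightarrow> 'm::finite two_form \<Rightarrow> bool" where
  "symplectic_form_on U \<omega> \<longleftrightarrow> two_form_on U \<omega> \<and>
     (\<forall>z\<in>U. \<forall>u v w. ext_deriv2 \<omega> z u v w = 0) \<and>
     (\<forall>z\<in>U. \<forall>u. (\<forall>v. \<omega> z u v = 0) \<longrightarrow> u = 0)"

definition liouvillian_form_on :: "(real^'m) set \<Rightarrow> 'm::finite two_form \<Rightarrow> 'm one_form \<Rightarrow> bool" where
  "liouvillian_form_on U \<omega> \<theta> \<longleftrightarrow> one_form_on U \<theta> \<and> (\<forall>z\<in>U. ext_deriv1 \<theta> z = \<omega> z)"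

definition linear_coefficients_on :: "(real^'m) set \<Rightarrow> 'm::finite one_form \<Rightarrow> bool" where
  "linear_coefficients_on U \<theta> \<longleftrightarrow>
     (\<exists>A :: real^'m^'m. \<forall>z\<in>U. \<theta> z = (\<Sum>i\<in>UNIV. (\<Sum>j\<in>UNIV. A $ i $ j * z $ j) *\<^sub>R dz i))"

text \<open>A chart is a pair \<open>(W, \<phi>)\<close> of its domain and its coordinate map. The dimension of the
  manifold is \<open>CARD('m)\<close>. The atlas need not be maximal.\<close>

type_synonym ('p, 'm) chart = "'p set \<times> ('p \<Rightarrow> real^'m)"

definition chart_image :: "('p, 'm) chart \<Rightarrow> (real^'m) set" where
  "chart_image c = snd c ` fst c"

definition overlap :: "('p, 'm) chart \<Rightarrow> ('p, 'm) chart \<Rightarrow> (real^'m) set" where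
  "overlap c c' = snd c ` (fst c \<inter> fst c')"

definition transition :: "('p, 'm) chart \<Rightarrow> ('p, 'm) chart \<Rightarrow> real^'m \<Rightarrow> real^'m" where
  "transition c c' = snd c' \<circ> inv_into (fst c) (snd c)"

definition smooth_manifold :: "'p topology \<Rightarrow> ('p, 'm::finite) chart set \<Rightarrow> bool" where
  "smooth_manifold M \<A> \<longleftrightarrow>
     Hausdorff_space M \<and> second_countable M \<and>
     (\<Union>c\<in>\<A>. fst c) = topspace M \<and>
     (\<forall>c\<in>\<A>. openin M (fst c) \<and> open (chart_image c) \<and>
        homeomorphic_map (subtopology M (fst c)) (top_of_set (chart_image c)) (snd c)) \<and>
     (\<forall>c\<in>\<A>. \<forall>c'\<in>\<A>. smooth_on (transition c c') (overlap c c'))"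

text \<open>A form on a manifold is the family of its coordinate representations, which are
  related by pullback along the transition maps.\<close>

definition mfd_one_form :: "('p, 'm::finite) chart set \<Rightarrow> (('p, 'm) chart \<Rightarrow> 'm one_form) \<Rightarrow> bool" where
  "mfd_one_form \<A> \<theta> \<longleftrightarrow>
     (\<forall>c\<in>\<A>. one_form_on (chart_image c) (\<theta> c)) \<and>
     (\<forall>c\<in>\<A>. \<forall>c'\<in>\<A>. \<forall>x\<in>overlap c c'. \<forall>u.
        blinfun_apply (\<theta> c x) u =
        blinfun_apply (\<theta> c' (transition c c' x)) (frechet_derivative (transition c c') (at x) u))"

definition mfd_two_form :: "('p, 'm::finite) chart set \<Rightarrow> (('p, 'm) chart \<Rightarrow> 'm two_form) \<Rightarrow> bool" where
  "mfd_two_form \<A> \<omega> \<longleftrightarrow>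
     (\<forall>c\<in>\<A>. two_form_on (chart_image c) (\<omega> c)) \<and>
     (\<forall>c\<in>\<A>. \<forall>c'\<in>\<A>. \<forall>x\<in>overlap c c'. \<forall>u v.
        \<omega> c x u v =
        \<omega> c' (transition c c' x) (frechet_derivative (transition c c') (at x) u)
                                 (frechet_derivative (transition c c') (at x) v))"

definition symplectic_manifold ::
  "'p topology \<Rightarrow> ('p, 'm::finite) chart set \<Rightarrow> (('p, 'm) chart \<Rightarrow> 'm two_form) \<Rightarrow> bool" where
  "symplectic_manifold M \<A> \<omega> \<longleftrightarrow> smooth_manifold M \<A> \<and> mfd_two_form \<A> \<omega> \<and>
     (\<forall>c\<in>\<A>. symplectic_form_on (chart_image c) (\<omega> c))"

definition exact_symplectic_manifold ::
  "'p topology \<Rightarrow> ('p, 'm::finite) chart set \<Rightarrow> (('p, 'm) chart \<Rightarrow> 'm two_form) \<Rightarrow> bool" where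
  "exact_symplectic_manifold M \<A> \<omega> \<longleftrightarrow> symplectic_manifold M \<A> \<omega> \<and>
     (\<exists>\<theta>. mfd_one_form \<A> \<theta> \<and> (\<forall>c\<in>\<A>. liouvillian_form_on (chart_image c) (\<omega> c) (\<theta> c)))"

text \<open>Having linear coefficients only makes sense relative to a chart, and the forms concerned
  are those on the domain of that chart, an open submanifold with this single chart as an atlas.
  They are given by their coordinate representations.\<close>

definition linear_liouvillian_forms ::
  "(('p, 'm::finite) chart \<Rightarrow> 'm two_form) \<Rightarrow> ('p, 'm) chart \<Rightarrow> 'm one_form set" where
  "linear_liouvillian_forms \<omega> c =
     {\<theta>. liouvillian_form_on (chart_image c) (\<omega> c) \<theta> \<and> linear_coefficients_on (chart_image c) \<theta>}"

end

theory Submission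
  imports Defs
begin

text \<open>The form \<open>\<Sum>\<^sub>i (A z)\<^sub>i dz\<^sub>i\<close> has exterior derivative
  \<open>(u, v) \<mapsto> \<langle>A u, v\<rangle> - \<langle>A v, u\<rangle>\<close>, while \<open>\<omega> (u, v) = \<langle>J u, v\<rangle>\<close>. So the form is
  Liouvillian iff \<open>A - A\<^sup>T = J\<close>, i.e. iff \<open>A - J/2\<close> is symmetric. Since \<open>A\<close> can be read off
  from the derivative of the form at any one point, the forms concerned make up an affine space
  directed by the symmetric matrices, whose dimension is the number \<open>n(2n+1)\<close> of subsets of the
  index set with one or two elements.\<close>

lemma sum_fun_apply: "(\<Sum>i\<in>I. f i) x = (\<Sum>i\<in>I. f i x)"
  by (induction I rule: infinite_finite_induct) auto

text \<open>The translation cancels in differences of points, and the differences of elements of a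
  subspace fill the subspace, so \<open>B\<close> itself is the required basis.\<close>

lemma has_affine_dim_translation:
  assumes "finite B" "independent B"
  shows "has_affine_dim ((+) a ` span B) (card B)"
proof -
  have "{x - y | x y. x \<in> (+) a ` span B \<and> y \<in> (+) a ` span B} = {x - y | x y. x \<in> span B \<and> y \<in> span B}"
    by (auto simp: image_iff) (metis add_diff_cancel_left)+
  also have "\<dots> = span B"
    by (auto intro: span_diff) (metis diff_zero span_zero)
  finally have "span B = {x - y | x y. x \<in> (+) a ` span B \<and> y \<in> (+) a ` span B}" ..
  moreover have "affine ((+) a ` span B)"
    using affine_translation subspace_imp_affine subspace_span by blast
  moreover have "(+) a ` span B \<noteq> {}"
    using span_zero by blast
  ultimately show ?thesis
    unfolding has_affine_dim_def using assms by blast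
qed

section \<open>Smoothness\<close>

text \<open>At a point of an open set the derivative depends only on values nearby, so
  \<open>f\<close> and \<open>g\<close> may differ outside \<open>U\<close>. This makes it harmless
  to set forms to 0 there.\<close>

lemma Ck_on_cong:
  assumes "open U" "\<And>x. x \<in> U \<Longrightarrow> f x = g x"
  shows "Ck_on k f U \<longleftrightarrow> Ck_on k g U"
proof -
  have *: "Ck_on k g U" if "Ck_on k f U" "\<And>x. x \<in> U \<Longrightarrow> f x = g x" for f g
    using that
  proof (induction k arbitrary: f g)
    case 0
    then show ?case by (simp cong: continuous_on_cong)
  next
    case (Suc k)
    have "(f has_derivative frechet_derivative f (at x)) (at x)" if "x \<in> U" for x
      using Suc.prems(1) that \<open>open U\<close>
      by (simp add: differentiable_on_eq_differentiable_at flip: frechet_derivative_works)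
    then have der: "(g has_derivative frechet_derivative f (at x)) (at x)" if "x \<in> U" for x
      by (rule has_derivative_transform_within_open[OF _ \<open>open U\<close> that Suc.prems(2)])
        (use that in blast)+
    then have "g differentiable_on U"
      by (meson differentiableI differentiable_at_withinI differentiable_on_def)
    moreover have "Ck_on k (\<lambda>x. frechet_derivative g (at x) v) U" for v
    proof (rule Suc.IH)
      show "Ck_on k (\<lambda>x. frechet_derivative f (at x) v) U"
        using Suc.prems(1) by simp
      show "frechet_derivative f (at x) v = frechet_derivative g (at x) v" if "x \<in> U" for x
        using frechet_derivative_at[OF der[OF that]] by simp
    qed
    ultimately show ?case by simp
  qed
  show ?thesis
    using *[of f g] *[of g f] assms(2) by auto
qed

lemma Ck_on_const: "Ck_on k (\<lambda>x. a) U"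
  by (induction k arbitrary: a) auto

lemma smooth_on_bounded_linear:
  assumes "bounded_linear f"
  shows "smooth_on f U"
proof -
  have f: "(f has_derivative f) F" for F
    using assms by (rule bounded_linear_imp_has_derivative)
  have "Ck_on k f U" for k
  proof (cases k)
    case 0
    then show ?thesis
      using assms by (simp add: linear_continuous_on)
  next
    case (Suc l)
    \<comment> \<open>A bounded linear map is its own derivative at every point, so its directional
      derivatives are constant in \<open>x\<close> and no induction on the order is needed.\<close>
    have "frechet_derivative f (at x) = f" for x
      using frechet_derivative_at[OF f] by simp
    then show ?thesis
      using Suc f by (auto simp: Ck_on_const differentiable_on_def differentiable_def)
  qed
  then show ?thesis
    by (simp add: smooth_on_def)
qed

section \<open>Symmetric matrices\<close>

text \<open>In terms of elementary matrices this is \<open>E_ij + E_ji\<close> for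
  \<open>s = {i, j}\<close> with \<open>i \<noteq> j\<close>, and \<open>E_ii\<close> for
  \<open>s = {i}\<close>. Indexing by unordered pairs avoids choosing an order on the index
  type.\<close>

definition sym_unit :: "'m set \<Rightarrow> real^'m::finite^'m" where
  "sym_unit s = (\<chi> i j. if {i, j} = s then 1 else 0)"

definition small_sets :: "'m::finite set set" where
  "small_sets = {s. card s = 1 \<or> card s = 2}"

lemma doubleton_in_small_sets: "{i, j} \<in> small_sets"
  by (cases "i = j") (auto simp: small_sets_def)

lemma small_setsE:
  assumes "s \<in> small_sets"
  obtains i j where "s = {i, j}"
proof -
  from assms consider "card s = 1" | "card s = 2"
    by (auto simp: small_sets_def)
  then show thesis
    by cases (metis card_1_singletonE insert_absorb2 that, metis card_2_iff that)
qed

text \<open>Only \<open>s = {i, j}\<close> contributes to the entry at \<open>(i, j)\<close>. Since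
  coefficients are thus entries, this yields both independence and spanning.\<close>

lemma sum_sym_unit_nth:
  "(\<Sum>s\<in>small_sets. a s *\<^sub>R sym_unit s) $ i $ j = a {i, j}"
proof -
  have "(\<Sum>s\<in>small_sets. a s *\<^sub>R sym_unit s) $ i $ j
      = (\<Sum>s\<in>small_sets. if s = {i, j} then a s else 0)"
    unfolding sum_component by (rule sum.cong) (auto simp: sym_unit_def)
  then show ?thesis
    by (simp add: doubleton_in_small_sets)
qed

lemma card_small_sets: "card (small_sets :: 'm::finite set set) = CARD('m) + (CARD('m) choose 2)"
proof -
  have "(small_sets :: 'm set set) = {s. s \<subseteq> UNIV \<and> card s = 1} \<union> {s. s \<subseteq> UNIV \<and> card s = 2}"
    by (auto simp: small_sets_def)
  also have "card \<dots> = card {s::'m set. s \<subseteq> UNIV \<and> card s = 1} + card {s::'m set. s \<subseteq> UNIV \<and> card s = 2}"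
    by (rule card_Un_disjoint) auto
  also have "\<dots> = CARD('m) + (CARD('m) choose 2)"
    by (simp only: n_subsets[OF finite]) simp
  finally show ?thesis .
qed

text \<open>The position of any entry 1 determines the index set. Sets outside
  \<open>small_sets\<close> all give the zero matrix.\<close>

lemma inj_on_sym_unit: "inj_on sym_unit (small_sets :: 'm::finite set set)"
proof (rule inj_onI)
  fix s t :: "'m set"
  assume "s \<in> small_sets" and eq: "sym_unit s = sym_unit t"
  then obtain i j where s: "s = {i, j}"
    by (auto elim: small_setsE)
  have "sym_unit s $ i $ j = 1"
    by (simp add: sym_unit_def s)
  then have "sym_unit t $ i $ j = 1"
    unfolding eq .
  then show "s = t"
    using s by (simp add: sym_unit_def split: if_splits)
qed

lemma independent_sym_unit: "independent (sym_unit ` (small_sets :: 'm::finite set set))"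
proof (rule independent_if_scalars_zero)
  fix f :: "real^'m::finite^'m \<Rightarrow> real" and x :: "real^'m^'m"
  assume "(\<Sum>x\<in>sym_unit ` small_sets. f x *\<^sub>R x) = 0"
  then have 0: "(\<Sum>s\<in>small_sets. f (sym_unit s) *\<^sub>R sym_unit s :: real^'m^'m) = 0"
    by (simp add: sum.reindex inj_on_sym_unit)
  assume "x \<in> sym_unit ` small_sets"
  then obtain i j where "x = sym_unit {i, j}"
    by (metis imageE small_setsE)
  then show "f x = 0"
    using sum_sym_unit_nth[of "\<lambda>s. f (sym_unit s)" i j] 0 by simp
qed simp

lemma span_sym_unit: "span (sym_unit ` small_sets) = {A :: real^'m::finite^'m. transpose A = A}"
proof
  have "subspace {A :: real^'m^'m. transpose A = A}"
    by (auto simp: subspace_def transpose_def vec_eq_iff)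
  moreover have "transpose (sym_unit s) = (sym_unit s :: real^'m^'m)" for s
    by (simp add: transpose_def sym_unit_def vec_eq_iff insert_commute)
  ultimately show "span (sym_unit ` small_sets) \<subseteq> {A :: real^'m^'m. transpose A = A}"
    by (intro span_minimal) auto
next
  show "{A :: real^'m^'m. transpose A = A} \<subseteq> span (sym_unit ` small_sets)"
  proof clarify
    fix A :: "real^'m^'m"
    assume "transpose A = A"
    then have sym: "A $ i $ j = A $ j $ i" for i j
      by (metis transpose_def vec_lambda_beta)
    \<comment> \<open>The entry of \<open>A\<close> at an unordered pair. By symmetry of
      \<open>A\<close> it does not matter in which order \<open>i\<close> and \<open>j\<close> are
      taken.\<close>
    define a where "a s = (SOME x. \<exists>i j. s = {i, j} \<and> x = A $ i $ j)" for s
    have "a {i, j} = A $ i $ j" for i j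
      unfolding a_def by (rule some_equality) (auto simp: doubleton_eq_iff sym)
    then have "A = (\<Sum>s\<in>small_sets. a s *\<^sub>R sym_unit s)"
      by (simp add: vec_eq_iff sum_sym_unit_nth del: sum_component)
    also have "\<dots> \<in> span (sym_unit ` small_sets)"
      by (intro span_sum span_scale span_base imageI)
    finally show "A \<in> span (sym_unit ` small_sets)" .
  qed
qed

section \<open>Forms with linear coefficients\<close>

lemma dz_apply [simp]: "blinfun_apply (dz i) v = v $ i"
  unfolding dz_def by (simp add: bounded_linear_Blinfun_apply[OF bounded_linear_vec_nth])

definition linear_form :: "real^'m::finite^'m \<Rightarrow> 'm one_form" where
  "linear_form A z = (\<Sum>i\<in>UNIV. (\<Sum>j\<in>UNIV. A $ i $ j * z $ j) *\<^sub>R dz i)"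

lemma linear_form_apply: "blinfun_apply (linear_form A z) v = (A *v z) \<bullet> v"
  by (simp add: linear_form_def blinfun.sum_left blinfun.scaleR_left inner_vec_def
      matrix_vector_mult_def)

lemma bounded_linear_linear_form: "bounded_linear (linear_form A)"
proof -
  have "linear (linear_form A)"
    by (rule linearI; rule blinfun_eqI)
      (simp_all add: linear_form_apply blinfun.add_left blinfun.scaleR_left inner_add_left
        matrix_vector_right_distrib matrix_vector_mult_scaleR)
  then show ?thesis
    by (rule linear_conv_bounded_linear[THEN iffD1])
qed

text \<open>The value 0 outside \<open>U\<close> is the normalisation demanded by
  \<open>one_form_on\<close>.\<close>

definition linear_form_on :: "(real^'m) set \<Rightarrow> real^'m::finite^'m \<Rightarrow> 'm one_form" where
  "linear_form_on U A z = (if z \<in> U then linear_form A z else 0)"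

text \<open>Linearity is meant in the matrix, not in the point: it carries affine spaces of matrices
  to affine spaces of forms.\<close>

lemma linear_linear_form_on: "linear (linear_form_on U)"
  by (rule linearI; rule ext; rule blinfun_eqI)
    (simp_all add: linear_form_on_def scaleR_fun_def linear_form_apply blinfun.add_left
      blinfun.scaleR_left inner_add_left matrix_vector_mult_add_rdistrib
      scaleR_matrix_vector_assoc[symmetric])

lemma one_form_on_linear_form_on:
  assumes "open U"
  shows "one_form_on U (linear_form_on U A)"
proof -
  have "smooth_on (linear_form_on U A) U \<longleftrightarrow> smooth_on (linear_form A) U"
    unfolding smooth_on_def
    by (intro all_cong1 Ck_on_cong assms) (simp add: linear_form_on_def)
  then show ?thesis
    by (simp add: one_form_on_def linear_form_on_def smooth_on_bounded_linear
        bounded_linear_linear_form)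
qed

lemma frechet_derivative_linear_form_on:
  assumes "open U" "z \<in> U"
  shows "frechet_derivative (linear_form_on U A) (at z) = linear_form A"
proof -
  have "(linear_form_on U A has_derivative linear_form A) (at z)"
    by (rule has_derivative_transform_within_open
        [OF bounded_linear_imp_has_derivative[OF bounded_linear_linear_form] assms])
      (simp add: linear_form_on_def)
  then show ?thesis
    by (rule frechet_derivative_at[symmetric])
qed

text \<open>The derivative at a single point of \<open>U\<close> is \<open>linear_form A\<close> on
  the whole space, which determines \<open>A\<close> however small \<open>U\<close> is.\<close>

lemma inj_linear_form_on:
  assumes "open U" "U \<noteq> {}"
  shows "inj (linear_form_on U)"
proof (rule injI)
  fix A B :: "real^'a^'a"
  assume "linear_form_on U A = linear_form_on U B"
  then have "linear_form A = linear_form B"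
    using frechet_derivative_linear_form_on assms by (metis ex_in_conv)
  then have "(A *v u) \<bullet> v = (B *v u) \<bullet> v" for u v
    by (metis linear_form_apply)
  then have "A *v u = B *v u" for u
    using vector_eq_rdot by blast
  then show "A = B"
    by (simp add: matrix_eq)
qed

section \<open>The Liouville condition as a matrix equation\<close>

lemma linear_form_antisym_part:
  fixes A :: "real^'m::finite^'m"
  shows "(A *v u) \<bullet> v - (A *v v) \<bullet> u = ((A - transpose A) *v u) \<bullet> v"
proof -
  have "(A *v v) \<bullet> u = (transpose A *v u) \<bullet> v"
    unfolding transpose_matrix_vector dot_lmul_matrix by (rule inner_commute)
  then show ?thesis
    by (simp only: matrix_vector_mult_diff_rdistrib inner_diff_left)
qed

lemma ext_deriv1_linear_form_on:
  assumes "open U" "z \<in> U"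
  shows "ext_deriv1 (linear_form_on U A) z = (\<lambda>u v. ((A - transpose A) *v u) \<bullet> v)"
  by (intro ext) (simp add: ext_deriv1_def frechet_derivative_linear_form_on assms
      linear_form_apply linear_form_antisym_part)

text \<open>As both forms vanish outside \<open>U\<close>, agreement on \<open>U\<close> is equality
  of functions.\<close>

lemma linear_coefficients_on_iff:
  assumes "one_form_on U \<theta>"
  shows "linear_coefficients_on U \<theta> \<longleftrightarrow> (\<exists>A. \<theta> = linear_form_on U A)"
proof -
  have "(\<forall>z\<in>U. \<theta> z = linear_form A z) \<longleftrightarrow> \<theta> = linear_form_on U A" for A
    using assms by (auto simp: one_form_on_def linear_form_on_def fun_eq_iff)
  then show ?thesis
    by (simp add: linear_coefficients_on_def flip: linear_form_def)
qed

text \<open>The two terms of each \<open>wedge\<close> add up to half of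
  \<open>(J *v u) \<bullet> v - (J *v v) \<bullet> u\<close>, and antisymmetry of \<open>J\<close>
  makes this difference twice its first term.\<close>

lemma standard_two_form_eq:
  fixes J :: "real^'m::finite^'m"
  assumes "transpose J = - J"
  shows "(\<Sum>i\<in>UNIV. \<Sum>j\<in>UNIV. (1/2 * J $ i $ j) *\<^sub>R wedge (dz j) (dz i)) = (\<lambda>u v. (J *v u) \<bullet> v)"
proof (intro ext)
  fix u v :: "real^'m"
  have bil: "(J *v x) \<bullet> y = (\<Sum>i\<in>UNIV. \<Sum>j\<in>UNIV. J $ i $ j * (x $ j * y $ i))" for x y
    by (simp add: inner_vec_def matrix_vector_mult_def sum_distrib_left sum_distrib_right mult_ac)
  have "(\<Sum>i\<in>UNIV. \<Sum>j\<in>UNIV. (1/2 * J $ i $ j) *\<^sub>R wedge (dz j) (dz i)) u v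
      = (\<Sum>i\<in>UNIV. \<Sum>j\<in>UNIV. 1/2 * (J $ i $ j * (u $ j * v $ i) - J $ i $ j * (v $ j * u $ i)))"
    by (simp add: sum_fun_apply scaleR_fun_def wedge_def algebra_simps)
  also have "\<dots> = 1/2 * ((J *v u) \<bullet> v - (J *v v) \<bullet> u)"
    by (simp only: bil sum_subtractf[symmetric] sum_distrib_left[symmetric])
  also have "\<dots> = (J *v u) \<bullet> v"
    unfolding linear_form_antisym_part assms diff_minus_eq_add matrix_vector_mult_add_rdistrib
      inner_add_left by simp
  finally show "(\<Sum>i\<in>UNIV. \<Sum>j\<in>UNIV. (1/2 * J $ i $ j) *\<^sub>R wedge (dz j) (dz i)) u v = (J *v u) \<bullet> v" .
qed

text \<open>On \<open>U\<close> neither the exterior derivative nor \<open>\<omega>\<close> depends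
  on the point, so one point of \<open>U\<close> carries the whole condition; and a matrix is
  determined by its bilinear form.\<close>

lemma liouvillian_linear_form_on_iff:
  assumes "open U" "U \<noteq> {}" "\<And>z. z \<in> U \<Longrightarrow> \<omega> z = (\<lambda>u v. (J *v u) \<bullet> v)"
  shows "liouvillian_form_on U \<omega> (linear_form_on U A) \<longleftrightarrow> A - transpose A = J"
proof -
  have "A - transpose A = J" if "\<And>u v. ((A - transpose A) *v u) \<bullet> v = (J *v u) \<bullet> v"
    unfolding matrix_eq using that vector_eq_rdot by blast
  moreover have "liouvillian_form_on U \<omega> (linear_form_on U A) \<longleftrightarrow>
      (\<forall>u v. ((A - transpose A) *v u) \<bullet> v = (J *v u) \<bullet> v)"
    using assms
    by (auto simp: liouvillian_form_on_def one_form_on_linear_form_on ext_deriv1_linear_form_on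
        fun_eq_iff)
  ultimately show ?thesis
    by blast
qed

text \<open>An inhomogeneous linear equation: \<open>(1/2) *\<^sub>R J\<close> is a particular
  solution because \<open>J\<close> is antisymmetric, and the homogeneous solutions are the
  symmetric matrices.\<close>

lemma antisym_part_solutions:
  fixes J :: "real^'m::finite^'m"
  assumes "transpose J = - J"
  shows "{A. A - transpose A = J} = (+) ((1/2) *\<^sub>R J) ` {A. transpose A = A}"
proof -
  have "A - transpose A = J \<longleftrightarrow> transpose (A - (1/2) *\<^sub>R J) = A - (1/2) *\<^sub>R J" for A
  proof -
    have "transpose (A - (1/2) *\<^sub>R J) = transpose A - (1/2) *\<^sub>R transpose J"
      by (simp add: transpose_def vec_eq_iff)
    moreover have "(1/2) *\<^sub>R J + (1/2) *\<^sub>R J = J"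
      by (simp flip: scaleR_left.add)
    ultimately show ?thesis
      using assms by (auto simp: algebra_simps)
  qed
  then have "{A. A - transpose A = J} = {A. transpose (A - (1/2) *\<^sub>R J) = A - (1/2) *\<^sub>R J}"
    by blast
  also have "\<dots> = (+) ((1/2) *\<^sub>R J) ` {A. transpose A = A}"
  proof (intro set_eqI iffI)
    fix A
    assume "A \<in> {A. transpose (A - (1/2) *\<^sub>R J) = A - (1/2) *\<^sub>R J}"
    then show "A \<in> (+) ((1/2) *\<^sub>R J) ` {A. transpose A = A}"
      by (intro image_eqI[of _ _ "A - (1/2) *\<^sub>R J"]) auto
  qed auto
  finally show ?thesis .
qed

theorem lemma5p3:
  fixes n :: nat
    and M :: "'p topology"
    and \<A> :: "('p, 'm::finite) chart set"
    and \<omega> :: "('p, 'm) chart \<Rightarrow> 'm two_form"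
    and c :: "('p, 'm) chart"
    and J :: "real^'m^'m"
  assumes "CARD('m) = 2 * n"
    and "exact_symplectic_manifold M \<A> \<omega>"
    and "c \<in> \<A>" and "fst c \<noteq> {}"
    and "transpose J = - J" and "J ** J = - mat 1"
    and "\<And>z. z \<in> chart_image c \<Longrightarrow>
          \<omega> c z = (\<Sum>i\<in>UNIV. \<Sum>j\<in>UNIV. (1/2 * J $ i $ j) *\<^sub>R wedge (dz j) (dz i))"
  shows "has_affine_dim (linear_liouvillian_forms \<omega> c) (n * (2 * n + 1))"
proof -
  define U where "U = chart_image c"
  define L where "L = linear_form_on U"
  \<comment> \<open>A basis of the direction space: independence and cardinality pass from the
    symmetric units to \<open>B\<close> because \<open>L\<close> is linear and injective.\<close>
  define B where "B = L ` sym_unit ` small_sets"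
  have U: "open U" "U \<noteq> {}"
    using assms(2-4)
    by (auto simp: U_def chart_image_def exact_symplectic_manifold_def symplectic_manifold_def
        smooth_manifold_def)
  have \<omega>: "\<omega> c z = (\<lambda>u v. (J *v u) \<bullet> v)" if "z \<in> U" for z
    using assms(7) that standard_two_form_eq[OF assms(5)] by (simp add: U_def)
  have L: "linear L" "inj L"
    using U by (simp_all add: L_def linear_linear_form_on inj_linear_form_on)
  have span_B: "span B = L ` {A. transpose A = A}"
    unfolding B_def linear_span_image[OF L(1)] span_sym_unit ..
  have "linear_liouvillian_forms \<omega> c = L ` {A. A - transpose A = J}"
  proof -
    have "linear_liouvillian_forms \<omega> c = {L A | A. liouvillian_form_on U (\<omega> c) (L A)}"
      unfolding linear_liouvillian_forms_def U_def[symmetric] L_def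
      using linear_coefficients_on_iff[of U] by (auto simp: liouvillian_form_on_def)
    also have "\<dots> = L ` {A. A - transpose A = J}"
      unfolding L_def using liouvillian_linear_form_on_iff[OF U \<omega>] by auto
    finally show ?thesis .
  qed
  \<comment> \<open>The matrices form a translate of the symmetric ones, and a linear map sends
    translates to translates.\<close>
  also have "\<dots> = (+) (L ((1/2) *\<^sub>R J)) ` span B"
    unfolding antisym_part_solutions[OF assms(5)] span_B image_image
    by (simp add: linear_add[OF L(1)])
  finally have "linear_liouvillian_forms \<omega> c = (+) (L ((1/2) *\<^sub>R J)) ` span B" .
  moreover have "independent B"
    unfolding B_def using L(1) independent_sym_unit
    by (intro linear_independent_injective_image inj_on_subset[OF L(2)]) auto
  moreover have "card B = n * (2 * n + 1)"
  proof -
    have "card B = card (small_sets :: 'm set set)"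
      by (simp add: B_def card_image[OF inj_on_subset[OF L(2)]] card_image[OF inj_on_sym_unit])
    \<comment> \<open>This is \<open>2n + n(2n - 1)\<close>. The case \<open>n = 0\<close> is split
      off because subtraction on the naturals truncates.\<close>
    also have "\<dots> = n * (2 * n + 1)"
      unfolding card_small_sets assms(1) choose_two
      by (cases n) (simp_all add: algebra_simps)
    finally show ?thesis .
  qed
  ultimately show ?thesis
    using has_affine_dim_translation[of B] by (simp add: B_def)
qed

end
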